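(* Let $p$ be a positive integer and $n$ a positive integer. The set of $p$-Fibonacci polyominoes of area $n$ is in bijection with the set of compositions of $n$ all of whose parts lie in the set \[A_p=\left\{\tfrac12(p+i)(p-i+1):\ 1\le i\le p\right\}.\]
   Context: A $p$-Fibonacci word of length $n\ge 1$ is a word $u=u_1u_2\cdots u_n$ over $\{1,\dots,p\}$ with $u_1=p$ and, for $1\le i\le n-1$: if $u_i=1$ then $u_{i+1}=p$; if $2\le u_i\le p$ then $u_{i+1}\in\{u_i-1,\,p\}$. Each such word determines a polyomino (bargraph): $n$ adjacent columns of unit square cells resting on a common horizontal base line, the $i$-th column having $u_i$ cells; these are the $p$-Fibonacci polyominoes. The area of such a polyomino is its number of cells, i.e. $u_1+\cdots+u_n$. A composition of $n$ is a finite sequence of positive integers (parts) $(\sigma_1,\dots,\sigma_\ell)$ with $\sigma_1+\cdots+\sigma_\ell=n$. *)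

theory Defs
  imports Main
begin

definition fibonacci_word :: "nat \<Rightarrow> nat list \<Rightarrow> bool" where
  "fibonacci_word p u \<longleftrightarrow>
     u \<noteq> [] \<and> set u \<subseteq> {1..p} \<and> hd u = p \<and>
     (\<forall>i. Suc i < length u \<longrightarrow>
        (u ! i = 1 \<longrightarrow> u ! Suc i = p) \<and>
        (2 \<le> u ! i \<and> u ! i \<le> p \<longrightarrow> u ! Suc i \<in> {u ! i - 1, p}))"

(* A unit cell is identified with its lower left corner; the base line is the horizontal axis
   and the first column starts at the origin, so no quotient by translations is needed. *)
type_synonym cell = "nat \<times> nat"

definition bargraph :: "nat list \<Rightarrow> cell set" where
  "bargraph u = {(i, j). i < length u \<and> j < u ! i}"

definition fibonacci_polyominoes :: "nat \<Rightarrow> cell set set" where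
  "fibonacci_polyominoes p = bargraph ` {u. fibonacci_word p u}"

definition area :: "cell set \<Rightarrow> nat" where
  "area P = card P"

definition compositions :: "nat \<Rightarrow> nat list set" where
  "compositions n = {c. (\<forall>x \<in> set c. 0 < x) \<and> sum_list c = n}"

(* The product is even and i \<le> p, so neither div nor the subtraction truncates. *)
definition fibonacci_parts :: "nat \<Rightarrow> nat set" where
  "fibonacci_parts p = {(p + i) * (p - i + 1) div 2 | i. 1 \<le> i \<and> i \<le> p}"

end

theory Submission
  imports Defs
begin

text \<open>
  Cutting a Fibonacci word before each occurrence of \<open>p\<close> splits it uniquely into descending runs
  \<open>p, p - 1, \<dots>, i\<close> with \<open>1 \<le> i \<le> p\<close>, and any nonempty sequence of such runs is a Fibonacci word.
  The run ending in \<open>i\<close> has sum \<open>(p + i) (p - i + 1) / 2\<close>, which determines \<open>i\<close>; replacing every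
  run by its sum is the bijection.
\<close>

section \<open>Descending runs and their concatenations\<close>

definition run :: "nat \<Rightarrow> nat \<Rightarrow> nat list" where
  "run p i = rev [i..<Suc p]"

definition runs :: "nat \<Rightarrow> nat list \<Rightarrow> nat list" where
  "runs p is = concat (map (run p) is)"

lemma runs_Nil [simp]: "runs p [] = []"
  by (simp add: runs_def)

lemma runs_Cons [simp]: "runs p (i # is) = run p i @ runs p is"
  by (simp add: runs_def)

lemma runs_append [simp]: "runs p (is @ js) = runs p is @ runs p js"
  by (simp add: runs_def)

lemma run_self [simp]: "run p p = [p]"
  by (simp add: run_def)

lemma run_snoc: "i < p \<Longrightarrow> run p i = run p (Suc i) @ [i]"
  by (simp add: run_def upt_conv_Cons)

lemma run_Cons: "i \<le> p \<Longrightarrow> run p i = p # rev [i..<p]"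
  by (simp add: run_def)

lemma last_run: "i \<le> p \<Longrightarrow> last (run p i) = i"
  by (cases "i = p") (simp_all add: run_snoc)

lemma runs_eq_Nil_iff: "set is \<subseteq> {1..p} \<Longrightarrow> runs p is = [] \<longleftrightarrow> is = []"
  by (cases "is") (simp_all add: run_Cons)

section \<open>Existence and uniqueness of the decomposition into runs\<close>

lemma fibonacci_word_singleton: "fibonacci_word p [x] \<longleftrightarrow> 0 < p \<and> x = p"
  by (auto simp: fibonacci_word_def)

text \<open>Turns the condition on indices into one on the last letter, so that words can be handled
  by induction from the right. Only the step from \<open>last u\<close> to \<open>x\<close> is new;
  the conjunct \<open>0 < x\<close> forces the letter after 1 to be \<open>p\<close>.\<close>

lemma fibonacci_word_snoc:
  assumes "u \<noteq> []"
  shows "fibonacci_word p (u @ [x]) \<longleftrightarrow>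
           fibonacci_word p u \<and> (x = p \<or> 0 < x \<and> Suc x = last u)"
proof -
  let ?step = "\<lambda>a b. (a = 1 \<longrightarrow> b = p) \<and> (2 \<le> a \<and> a \<le> p \<longrightarrow> b \<in> {a - 1, p})"
  have chain: "(\<forall>i. Suc i < length (u @ [x]) \<longrightarrow> ?step ((u @ [x]) ! i) ((u @ [x]) ! Suc i)) \<longleftrightarrow>
      (\<forall>i. Suc i < length u \<longrightarrow> ?step (u ! i) (u ! Suc i)) \<and> ?step (last u) x"
    (is "?L \<longleftrightarrow> ?R")
  proof
    assume L: ?L
    have "?step (u ! i) (u ! Suc i)" if "Suc i < length u" for i
      using L[rule_format, of i] that by (simp add: nth_append)
    moreover have "?step (last u) x"
      using L[rule_format, of "length u - 1"] assms by (simp add: nth_append last_conv_nth)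
    ultimately show ?R by blast
  next
    assume R: ?R
    show ?L
    proof (intro allI impI)
      fix i assume "Suc i < length (u @ [x])"
      then consider "Suc i < length u" | "Suc i = length u" by fastforce
      then show "?step ((u @ [x]) ! i) ((u @ [x]) ! Suc i)"
      proof cases
        case 1
        with R show ?thesis by (simp add: nth_append)
      next
        case 2
        then have "last u = u ! i" using assms by (simp add: last_conv_nth flip: 2)
        with R 2 show ?thesis by (simp add: nth_append)
      qed
    qed
  qed
  \<comment> \<open>The letters lie between 1 and \<open>p\<close>, so exactly one of the two
    implications in \<open>?step\<close> applies to \<open>last u\<close>.\<close>
  have "last u \<in> set u" using assms by simp
  then have "set u \<subseteq> {1..p} \<Longrightarrow> 1 \<le> last u \<and> last u \<le> p" by auto
  then show ?thesis
    unfolding fibonacci_word_def chain using assms by auto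
qed

text \<open>The run grows at its right end: it starts as the single letter \<open>p\<close>, which
  may follow any letter, and each further letter is one less than the last.\<close>

lemma fibonacci_word_append_run:
  assumes "u = [] \<or> fibonacci_word p u" and "1 \<le> i" and "i \<le> p"
  shows "fibonacci_word p (u @ run p i)"
  using assms(3,2)
proof (induction rule: inc_induct)
  case base
  with assms show ?case
    by (cases "u = []") (auto simp: fibonacci_word_singleton fibonacci_word_snoc)
next
  case (step i)
  have ne: "u @ run p (Suc i) \<noteq> []" using step.hyps by (simp add: run_Cons)
  have "last (u @ run p (Suc i)) = Suc i"
    using step.hyps last_run[of "Suc i" p] by (simp add: run_Cons)
  with step fibonacci_word_snoc[OF ne, of p i] show ?case
    by (simp add: run_snoc)
qed

lemma fibonacci_word_runs:
  "is \<noteq> [] \<Longrightarrow> set is \<subseteq> {1..p} \<Longrightarrow> fibonacci_word p (runs p is)"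
proof (induction "is" rule: rev_induct)
  case (snoc i "is")
  then show ?case
    using fibonacci_word_append_run[of "runs p is" p i] by (cases "is = []") auto
qed simp

text \<open>Induction from the right: a new letter \<open>p\<close> opens a run of length one, and
  any other letter prolongs the last run, so that only the last entry of the sequence
  changes.\<close>

lemma fibonacci_word_runsE:
  assumes "fibonacci_word p u"
  obtains "is" where "is \<noteq> []" and "set is \<subseteq> {1..p}" and "u = runs p is"
proof -
  have "\<exists>is. is \<noteq> [] \<and> set is \<subseteq> {1..p} \<and> u = runs p is"
    using assms
  proof (induction u rule: rev_induct)
    case Nil
    then show ?case by (simp add: fibonacci_word_def)
  next
    case (snoc x u)
    show ?case
    proof (cases "u = []")
      case True
      with snoc.prems show ?thesis
        by (intro exI[of _ "[p]"]) (auto simp: fibonacci_word_singleton)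
    next
      case False
      with snoc.prems have u: "fibonacci_word p u" and x: "x = p \<or> 0 < x \<and> Suc x = last u"
        by (auto simp: fibonacci_word_snoc)
      from snoc.IH[OF u] obtain js i where js: "set (js @ [i]) \<subseteq> {1..p}" "u = runs p (js @ [i])"
        by (metis append_butlast_last_id)
      from js have last: "last u = i" using last_run[of i p] by (simp add: run_Cons)
      from x show ?thesis
      proof
        assume "x = p"
        with js show ?thesis by (intro exI[of _ "js @ [i, p]"]) auto
      next
        assume "0 < x \<and> Suc x = last u"
        with js last show ?thesis
          by (intro exI[of _ "js @ [x]"]) (auto simp: run_snoc)
      qed
    qed
  qed
  with that show thesis by blast
qed

text \<open>Within a run only the first letter equals \<open>p\<close>. Hence the letters below
  \<open>p\<close> that follow the leading \<open>p\<close> recover the first run, and induction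
  treats the rest.\<close>

lemma runs_inject:
  assumes "set is \<subseteq> {1..p}" and "set js \<subseteq> {1..p}" and "runs p is = runs p js"
  shows "is = js"
  using assms
proof (induction "is" arbitrary: js)
  case Nil
  then show ?case using runs_eq_Nil_iff[of js p] by simp
next
  case (Cons i "is")
  from Cons.prems obtain j js' where js: "js = j # js'"
    by (cases js) (auto simp: run_Cons)
  have tail: "takeWhile (\<lambda>x. x < p) (rev [k..<p] @ runs p ks) = rev [k..<p]"
    if "set ks \<subseteq> {1..p}" for k ks
  proof -
    have "takeWhile (\<lambda>x. x < p) (runs p ks) = []"
      using that by (cases ks) (auto simp: run_Cons)
    then show ?thesis by (subst takeWhile_append2) auto
  qed
  have eq: "rev [i..<p] @ runs p is = rev [j..<p] @ runs p js'"
    using Cons.prems by (simp add: js run_Cons)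
  then have "rev [i..<p] = rev [j..<p]"
    using tail[of "is" i] tail[of js' j] Cons.prems by (simp add: js)
  \<comment> \<open>The length determines where the run ends; the bounds by \<open>p\<close> are
    needed because the subtraction truncates.\<close>
  moreover from this have "p - i = p - j" by (metis length_rev length_upt)
  moreover have "i \<le> p" "j \<le> p" using Cons.prems(1,2) by (simp_all add: js)
  ultimately have "i = j" and "runs p is = runs p js'" using eq by simp_all
  moreover from this(2) have "is = js'"
    using Cons.prems(1,2) by (intro Cons.IH) (simp_all add: js)
  ultimately show ?case by (simp add: js)
qed

lemma inj_on_runs: "inj_on (runs p) {is. set is \<subseteq> {1..p}}"
  using runs_inject by (intro inj_onI) blast

section \<open>Sums of runs\<close>

lemma sum_list_run:
  assumes "i \<le> p"
  shows "sum_list (run p i) = (p + i) * (p - i + 1) div 2"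
proof -
  have "2 * sum_list (run p i) = (p + i) * (p - i + 1)"
    using assms
  proof (induction rule: inc_induct)
    case (step i)
    \<comment> \<open>Writing \<open>p\<close> as a sum removes the truncated subtraction before the
      algebra.\<close>
    from step.hyps obtain d where "p = Suc (i + d)" using less_iff_Suc_add by auto
    with step show ?case by (simp add: run_snoc algebra_simps)
  qed simp
  then show ?thesis by simp
qed

lemma fibonacci_parts_eq: "fibonacci_parts p = (\<lambda>i. sum_list (run p i)) ` {1..p}"
  by (force simp: fibonacci_parts_def sum_list_run)

lemma fibonacci_parts_pos: "x \<in> fibonacci_parts p \<Longrightarrow> 0 < x"
  by (auto simp: fibonacci_parts_eq run_Cons)

text \<open>The run ending in \<open>j\<close> is a proper prefix of the one ending in
  \<open>i\<close>, and the letters that remain are positive.\<close>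

lemma sum_list_run_strict_antimono:
  assumes "1 \<le> i" and "i < j" and "j \<le> p"
  shows "sum_list (run p j) < sum_list (run p i)"
proof -
  have "run p i = run p j @ rev [i..<j]"
    using assms upt_add_eq_append[of i j "Suc p - j"] by (simp add: run_def)
  moreover have "0 < sum_list [i..<j]"
    using assms by (simp add: upt_conv_Cons)
  ultimately show ?thesis by simp
qed

lemma inj_on_sum_list_run: "inj_on (\<lambda>i. sum_list (run p i)) {1..p}"
  by (rule linorder_inj_onI) (use sum_list_run_strict_antimono in fastforce)+

lemma sum_list_runs: "sum_list (runs p is) = sum_list (map (\<lambda>i. sum_list (run p i)) is)"
  by (induction "is") simp_all

section \<open>Bargraphs and their area\<close>

lemma bargraph_eq: "bargraph u = Sigma {..<length u} (\<lambda>i. {..<u ! i})"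
  by (auto simp: bargraph_def)

lemma area_bargraph: "area (bargraph u) = sum_list u"
  by (simp add: area_def bargraph_eq sum_list_sum_nth atLeast0LessThan)

text \<open>As no column is empty, the projection to the base line shows the number of columns; the
  vertical sections then give the heights.\<close>

lemma bargraph_inject:
  assumes "\<forall>x \<in> set u. 0 < x" and "\<forall>x \<in> set v. 0 < x" and "bargraph u = bargraph v"
  shows "u = v"
proof -
  have base: "fst ` bargraph w = {..<length w}" if "\<forall>x \<in> set w. 0 < x" for w
    using that by (force simp: bargraph_eq image_iff)
  have len: "length u = length v"
    using base[OF assms(1)] base[OF assms(2)] assms(3) by simp
  have col: "{j. (i, j) \<in> bargraph w} = {..<w ! i}" if "i < length w" for i w
    using that by (auto simp: bargraph_eq)
  show ?thesis
    using len col[of _ u] col[of _ v] assms(3) by (intro nth_equalityI) (auto simp: lessThan_eq_iff)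
qed

lemma inj_on_bargraph: "inj_on bargraph {u. fibonacci_word p u}"
  by (intro inj_onI bargraph_inject) (auto simp: fibonacci_word_def)

theorem theorem2:
  fixes p n :: nat
  assumes "0 < p" and "0 < n"
  shows "\<exists>f. bij_betw f {P \<in> fibonacci_polyominoes p. area P = n}
                        {c \<in> compositions n. set c \<subseteq> fibonacci_parts p}"
proof -
  let ?s = "\<lambda>i. sum_list (run p i)"
  \<comment> \<open>The sequences of run ends, which are mapped bijectively to the polyominoes on
    one side and to the compositions on the other.\<close>
  let ?I = "{is. set is \<subseteq> {1..p} \<and> sum_list (map ?s is) = n}"
  let ?P = "{P \<in> fibonacci_polyominoes p. area P = n}"
  let ?C = "{c \<in> compositions n. set c \<subseteq> fibonacci_parts p}"
  \<comment> \<open>Here \<open>0 < n\<close> enters: the empty sequence would give the empty word,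
    which is not a Fibonacci word.\<close>
  have ne: "is \<noteq> []" if "is \<in> ?I" for "is"
    using that assms(2) by auto
  have "inj_on (bargraph \<circ> runs p) ?I"
  proof (rule comp_inj_on)
    show "inj_on (runs p) ?I"
      using inj_on_runs by (rule inj_on_subset) blast
    show "inj_on bargraph (runs p ` ?I)"
      using inj_on_bargraph by (rule inj_on_subset) (use ne fibonacci_word_runs in blast)
  qed
  moreover have "(bargraph \<circ> runs p) ` ?I = ?P"
  proof
    show "(bargraph \<circ> runs p) ` ?I \<subseteq> ?P"
      using ne by (auto simp: fibonacci_polyominoes_def area_bargraph sum_list_runs
          intro!: imageI fibonacci_word_runs)
    show "?P \<subseteq> (bargraph \<circ> runs p) ` ?I"
    proof
      fix P assume "P \<in> ?P"
      then obtain u where u: "fibonacci_word p u" "P = bargraph u" "sum_list u = n"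
        by (auto simp: fibonacci_polyominoes_def area_bargraph)
      from u(1) obtain "is" where "set is \<subseteq> {1..p}" "u = runs p is"
        by (rule fibonacci_word_runsE)
      with u show "P \<in> (bargraph \<circ> runs p) ` ?I"
        by (intro image_eqI[of _ _ "is"]) (simp_all add: sum_list_runs)
    qed
  qed
  ultimately have "bij_betw (bargraph \<circ> runs p) ?I ?P"
    by (simp add: bij_betw_def)
  moreover have "bij_betw (map ?s) ?I ?C"
  proof -
    \<comment> \<open>The bijection between run ends and parts acts entrywise on lists of any
      length; fixing the sum restricts it to \<open>?I\<close>.\<close>
    have "bij_betw (map ?s) (lists {1..p}) (lists (fibonacci_parts p))"
      by (intro bij_lists)
        (simp add: bij_betw_def inj_on_sum_list_run fibonacci_parts_eq del: One_nat_def)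
    then have "bij_betw (map ?s) {is \<in> lists {1..p}. sum_list (map ?s is) = n}
                 {c \<in> lists (fibonacci_parts p). sum_list c = n}"
      by (rule bij_betw_Collect) simp
    moreover have "{c \<in> lists (fibonacci_parts p). sum_list c = n} = ?C"
      using fibonacci_parts_pos by (auto simp: compositions_def)
    ultimately show ?thesis by (simp add: lists_eq_set)
  qed
  ultimately show ?thesis
    by (intro exI) (rule bij_betw_trans[OF bij_betw_inv_into])
qed

end
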